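(* Let $G=(L\cup R,E)$ be a bipartite graph with nonnegative edge weights $w_{uv}$, where the algorithm knows $L$, $R$ and the weights $w_{uv}$ of all pairs $(u,v)\in L\times R$ but not the edge set $E$. The weighted Ranking algorithm (defined in the context) is $(1-1/e)$-approximate for the edge-weighted oblivious matching problem: for every such $G$, the expected total weight of the matching it produces is at least $(1-1/e)\,W^*$, where $W^*$ is the weight of a maximum weight matching of $G$.
   Context: Edge-weighted oblivious (query-commit) bipartite matching: an adversary fixes a bipartite graph $G=(L\cup R,E)$ and a weight $w_{uv}\ge 0$ for each pair $u\in L$, $v\in R$; the algorithm knows the vertices and the weights but not $E$. An algorithm probes pairs $(u,v)$ of currently unmatched vertices one at a time; if $(u,v)\in E$, the pair is irrevocably added to the matching. Weighted Ranking algorithm: let $g(x)=e^{x-1}$. Each $u\in L$ independently draws a rank $y_u$ uniformly from $[0,1]$. The perturbed weight of a pair $(u,v)$, $u\in L$, $v\in R$, is $(1-g(y_u))\,w_{uv}$. All pairs are probed in descending order of perturbed weight (skipping pairs with an already matched endpoint), adding a pair to the matching when the edge exists. A (randomized) algorithm is $r$-approximate if for every graph the expected weight of its matching is at least $r\cdot W^*$. *)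

theory Defs
  imports "HOL-Probability.Probability"
begin

text \<open>
  The two sides of the bipartite graph live in separate types, so they are disjoint, and an edge is
  a pair in \<open>L \<times> R\<close>.
\<close>

definition is_matching :: "('a \<times> 'b) set \<Rightarrow> ('a \<times> 'b) set \<Rightarrow> bool" where
  "is_matching E M \<longleftrightarrow> M \<subseteq> E \<and> (\<forall>p\<in>M. \<forall>q\<in>M. fst p = fst q \<or> snd p = snd q \<longrightarrow> p = q)"

definition weight :: "('a \<Rightarrow> 'b \<Rightarrow> real) \<Rightarrow> ('a \<times> 'b) set \<Rightarrow> real" where
  "weight w M = (\<Sum>(u, v)\<in>M. w u v)"

text \<open>The maximum is over a finite nonempty set whenever \<open>E\<close> is finite.\<close>

definition max_matching_weight :: "('a \<Rightarrow> 'b \<Rightarrow> real) \<Rightarrow> ('a \<times> 'b) set \<Rightarrow> real" where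
  "max_matching_weight w E = Max (weight w ` {M. is_matching E M})"

text \<open>
  Probing a pair with a matched endpoint has no effect. This is the only place
  where the algorithm has access to the edge set.
\<close>

definition probe :: "('a \<times> 'b) set \<Rightarrow> 'a \<times> 'b \<Rightarrow> ('a \<times> 'b) set \<Rightarrow> ('a \<times> 'b) set" where
  "probe E p M =
    (if fst p \<notin> fst ` M \<and> snd p \<notin> snd ` M \<and> p \<in> E then insert p M else M)"

definition query_commit :: "('a \<times> 'b) set \<Rightarrow> ('a \<times> 'b) list \<Rightarrow> ('a \<times> 'b) set" where
  "query_commit E ps = fold (probe E) ps {}"

definition g :: "real \<Rightarrow> real" where
  "g x = exp (x - 1)"

definition perturbed_weight :: "('a \<Rightarrow> 'b \<Rightarrow> real) \<Rightarrow> ('a \<Rightarrow> real) \<Rightarrow> 'a \<times> 'b \<Rightarrow> real" where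
  "perturbed_weight w y = (\<lambda>(u, v). (1 - g (y u)) * w u v)"

text \<open>
  The list \<open>ps\<close> enumerates all pairs in \<open>L \<times> R\<close> and serves to break ties: the sort is stable, so
  pairs of equal perturbed weight are probed in the order in which they occur in \<open>ps\<close>. Such ties
  may occur with positive probability, namely between pairs of equal weight that share
  their left endpoint.
\<close>

definition probing_order ::
  "('a \<Rightarrow> 'b \<Rightarrow> real) \<Rightarrow> ('a \<times> 'b) list \<Rightarrow> ('a \<Rightarrow> real) \<Rightarrow> ('a \<times> 'b) list" where
  "probing_order w ps y = sort_key (\<lambda>p. - perturbed_weight w y p) ps"

definition weighted_ranking ::
  "('a \<Rightarrow> 'b \<Rightarrow> real) \<Rightarrow> ('a \<times> 'b) list \<Rightarrow> ('a \<times> 'b) set \<Rightarrow> ('a \<Rightarrow> real) \<Rightarrow> ('a \<times> 'b) set" where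
  "weighted_ranking w ps E y = query_commit E (probing_order w ps y)"

definition rank_space :: "'a set \<Rightarrow> ('a \<Rightarrow> real) measure" where
  "rank_space L = (\<Pi>\<^sub>M u\<in>L. uniform_measure lborel {0..1})"

lemma prob_space_rank_space: "prob_space (rank_space L)"
  unfolding rank_space_def
  by (intro prob_space_PiM prob_space_uniform_measure) auto

lemma is_matching_weighted_ranking: "is_matching E (weighted_ranking w ps E y)"
proof -
  have step: "is_matching E (probe E p M)" if "is_matching E M" for p :: "'a \<times> 'b" and M
    using that unfolding is_matching_def probe_def by (auto simp: image_iff)
  have "is_matching E M \<Longrightarrow> is_matching E (fold (probe E) qs M)" for qs M
    by (induction qs arbitrary: M) (auto intro: step)
  moreover have "is_matching E {}"
    by (simp add: is_matching_def)
  ultimately show ?thesis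
    unfolding weighted_ranking_def query_commit_def by blast
qed

end

theory Submission
  imports Defs
begin

text \<open>
  Primal-dual argument. A matched pair \<open>(u, v)\<close> splits its weight into \<open>g (y u) * w u v\<close> for \<open>u\<close>
  and the perturbed weight for \<open>v\<close>. It suffices that for every edge \<open>(u, v)\<close> the two endpoints
  receive at least \<open>(1 - 1 / e) * w u v\<close> in expectation, since the edges of a maximum weight
  matching are disjoint. Fix all ranks except that of \<open>u\<close> and let \<open>b\<close> be the gain of \<open>v\<close> when \<open>u\<close> is
  deleted. Inserting \<open>u\<close> only helps \<open>v\<close>, so \<open>v\<close> always gains at least \<open>b\<close>; and whenever
  \<open>(1 - g (y u)) * w u v > b\<close>, the vertex \<open>u\<close> is matched along a pair at least as heavy as \<open>(u, v)\<close>.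
  Integrating over \<open>y u\<close> gives the bound.
\<close>

section \<open>Probing a fixed order: the effect of deleting one left vertex\<close>

lemma probe_subset: "M \<subseteq> probe E p M" "probe E p M \<subseteq> insert p M"
  by (auto simp: probe_def)

lemma query_commit_Nil [simp]: "query_commit E [] = {}"
  by (simp add: query_commit_def)

lemma query_commit_snoc [simp]: "query_commit E (xs @ [p]) = probe E p (query_commit E xs)"
  by (simp add: query_commit_def)

lemma query_commit_append_mono: "query_commit E xs \<subseteq> query_commit E (xs @ ys)"
proof (induction ys rule: rev_induct)
  case (snoc y ys)
  then show ?case
    using probe_subset(1)[of "query_commit E (xs @ ys)" E y]
    by (metis append.assoc order_trans query_commit_snoc)
qed simp

lemma query_commit_subset: "query_commit E xs \<subseteq> set xs \<inter> E"
  by (induction xs rule: rev_induct) (auto simp: probe_def split: if_splits)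

lemma query_commit_filter:
  "query_commit {p \<in> E. P p} xs = query_commit {p \<in> E. P p} (filter P xs)"
proof (induction xs rule: rev_induct)
  case (snoc x xs)
  then show ?case by (cases "P x") (auto simp: probe_def)
qed simp

text \<open>The two inclusions form one invariant, since each needs the other to survive a probe: a
  pair away from \<open>u\<close> accepted in only one of the two runs must be blocked in the other
  at an endpoint that is already matched there. Only the sets of matched vertices are compared; the
  matchings themselves may differ.\<close>

lemma query_commit_remove_vertex:
  defines "E' \<equiv> \<lambda>E u. {p \<in> E. fst p \<noteq> u}"
  shows "fst ` query_commit E xs \<subseteq> insert u (fst ` query_commit (E' E u) xs)"
    and "snd ` query_commit (E' E u) xs \<subseteq> snd ` query_commit E xs"
proof -
  have "fst ` query_commit E xs \<subseteq> insert u (fst ` query_commit (E' E u) xs) \<and>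
        snd ` query_commit (E' E u) xs \<subseteq> snd ` query_commit E xs"
  proof (induction xs rule: rev_induct)
    case (snoc x xs)
    define A where "A = query_commit E xs"
    define B where "B = query_commit (E' E u) xs"
    have "fst ` A \<subseteq> insert u (fst ` B)" "snd ` B \<subseteq> snd ` A"
      using snoc by (auto simp: A_def B_def)
    then have "fst ` probe E x A \<subseteq> insert u (fst ` probe (E' E u) x B)"
      and "snd ` probe (E' E u) x B \<subseteq> snd ` probe E x A"
      unfolding probe_def E'_def by (simp_all split: if_splits) blast+
    then show ?case by (simp add: A_def B_def)
  qed simp
  then show "fst ` query_commit E xs \<subseteq> insert u (fst ` query_commit (E' E u) xs)"
    and "snd ` query_commit (E' E u) xs \<subseteq> snd ` query_commit E xs" by auto
qed

lemma query_commit_unmatched_vertex: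
  assumes "u \<notin> fst ` query_commit E xs"
  shows "query_commit {p \<in> E. fst p \<noteq> u} xs = query_commit E xs"
  using assms
proof (induction xs rule: rev_induct)
  case (snoc x xs)
  then have "u \<notin> fst ` query_commit E xs"
    using probe_subset(1)[of "query_commit E xs" E x] by auto
  then show ?case using snoc by (auto simp: probe_def split: if_splits)
qed simp

text \<open>When the run without \<open>u\<close> matches \<open>v\<close>, the full run has matched
  \<open>v\<close> no later. As \<open>f\<close> decreases along \<open>qs\<close>, the partner in
  the full run is at least as good.\<close>

lemma query_commit_vertex_improves:
  fixes f :: "'a \<times> 'b \<Rightarrow> real"
  assumes "sorted (map (\<lambda>p. - f p) qs)"
    and "(a, v) \<in> query_commit {p \<in> E. fst p \<noteq> u} qs"
  shows "\<exists>a'. (a', v) \<in> query_commit E qs \<and> f (a, v) \<le> f (a', v)"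
  using assms
proof (induction qs rule: rev_induct)
  case (snoc q qs)
  let ?E = "{p \<in> E. fst p \<noteq> u}"
  show ?case
  proof (cases "(a, v) \<in> query_commit ?E qs")
    case True
    with snoc obtain a' where "(a', v) \<in> query_commit E qs" "f (a, v) \<le> f (a', v)"
      by (auto simp: sorted_append)
    then show ?thesis using probe_subset(1)[of "query_commit E qs" E q] by auto
  next
    case False
    then have q: "q = (a, v)"
      using snoc.prems(2) probe_subset(2)[of ?E q "query_commit ?E qs"] by auto
    have "v \<in> snd ` query_commit E (qs @ [q])"
      using query_commit_remove_vertex(2)[of E u "qs @ [q]"] snoc.prems(2) by force
    then obtain a' where a': "(a', v) \<in> query_commit E (qs @ [q])" by auto
    then have "(a', v) \<in> insert q (set qs)"
      using query_commit_subset[of E "qs @ [q]"] by auto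
    then have "f (a, v) \<le> f (a', v)"
      using snoc.prems(1) q by (auto simp: sorted_append)
    with a' show ?thesis by blast
  qed
qed simp

text \<open>Consider the moment just before \<open>(u, v)\<close> is probed. If \<open>u\<close> is
  matched by then, its pair came earlier and is at least as heavy. Otherwise the run so far agrees
  with the one without \<open>u\<close>, so a partner of \<open>v\<close> would persist there with
  value at least \<open>f (u, v)\<close>, against \<open>beats\<close>; hence \<open>(u, v)\<close>
  is accepted.\<close>

lemma query_commit_vertex_matched:
  fixes f :: "'a \<times> 'b \<Rightarrow> real"
  assumes sorted: "sorted (map (\<lambda>p. - f p) qs)"
    and E: "(u, v) \<in> E" "(u, v) \<in> set qs"
    and beats: "\<And>a. (a, v) \<in> query_commit {p \<in> E. fst p \<noteq> u} qs \<Longrightarrow> f (a, v) < f (u, v)"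
  shows "\<exists>v'. (u, v') \<in> query_commit E qs \<and> f (u, v) \<le> f (u, v')"
proof -
  obtain xs ys where qs: "qs = xs @ (u, v) # ys"
    using E(2) by (meson split_list)
  have before: "f (u, v) \<le> f p" if "p \<in> set xs" for p
    using sorted that by (auto simp: qs sorted_append)
  show ?thesis
  proof (cases "u \<in> fst ` query_commit E xs")
    case True
    then obtain v' where "(u, v') \<in> query_commit E xs" by auto
    then have "(u, v') \<in> query_commit E qs" "f (u, v) \<le> f (u, v')"
      using before query_commit_subset[of E xs] query_commit_append_mono[of E xs "(u, v) # ys"]
      by (auto simp: qs)
    then show ?thesis by blast
  next
    case False
    have "v \<notin> snd ` query_commit E xs"
    proof
      assume "v \<in> snd ` query_commit E xs"
      then obtain a where a: "(a, v) \<in> query_commit E xs" by auto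
      then have "(a, v) \<in> query_commit {p \<in> E. fst p \<noteq> u} qs"
        using query_commit_unmatched_vertex[OF False]
          query_commit_append_mono[of "{p \<in> E. fst p \<noteq> u}" xs "(u, v) # ys"] by (auto simp: qs)
      moreover have "f (u, v) \<le> f (a, v)"
        using before a query_commit_subset[of E xs] by auto
      ultimately show False using beats by fastforce
    qed
    then have "(u, v) \<in> query_commit E (xs @ [(u, v)])"
      using False E(1) by (simp add: probe_def)
    then show ?thesis
      using query_commit_append_mono[of E "xs @ [(u, v)]" ys] by (auto simp: qs)
  qed
qed

section \<open>Measurability of the probing order\<close>

lemma insort_key_cong_le:
  fixes f :: "'c \<Rightarrow> 'd::linorder" and h :: "'c \<Rightarrow> 'e::linorder"
  assumes "\<And>y. y \<in> set xs \<Longrightarrow> f x \<le> f y \<longleftrightarrow> h x \<le> h y"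
  shows "insort_key f x xs = insort_key h x xs"
  using assms by (induction xs) auto

text \<open>Insertion sort inspects keys only through comparisons, so ties are also broken alike.
  This serves both measurability and independence from the rank of a deleted vertex.\<close>

lemma sort_key_cong_le:
  fixes f :: "'c \<Rightarrow> 'd::linorder" and h :: "'c \<Rightarrow> 'e::linorder"
  assumes "\<And>x y. x \<in> set xs \<Longrightarrow> y \<in> set xs \<Longrightarrow> f x \<le> f y \<longleftrightarrow> h x \<le> h y"
  shows "sort_key f xs = sort_key h xs"
  using assms
proof (induction xs)
  case (Cons x xs)
  then have "sort_key f xs = sort_key h xs" by simp
  then show ?case
    using Cons.prems by (auto intro!: insort_key_cong_le)
qed simp

lemma sets_rank_space: "sets (rank_space L) = sets (\<Pi>\<^sub>M u\<in>L. borel)"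
  unfolding rank_space_def by (intro sets_PiM_cong) auto

lemma measurable_rank_component:
  assumes "u \<in> L" shows "(\<lambda>y. y u) \<in> borel_measurable (rank_space L)"
  using assms by (subst measurable_cong_sets[OF sets_rank_space refl]) measurable

lemma g_measurable: "g \<in> borel_measurable borel"
  unfolding g_def[abs_def] by measurable

lemma g_bounds: "x \<le> 1 \<Longrightarrow> g x \<le> 1" "0 < g x"
  by (auto simp: g_def)

lemma borel_measurable_g_rank:
  assumes "u \<in> L"
  shows "(\<lambda>y. g (y u)) \<in> borel_measurable (rank_space L)"
  using measurable_compose[OF measurable_rank_component[OF assms] g_measurable] .

lemma borel_measurable_perturbed_weight:
  assumes "fst p \<in> L"
  shows "(\<lambda>y. perturbed_weight w y p) \<in> borel_measurable (rank_space L)"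
  unfolding perturbed_weight_def case_prod_beta
  by (intro borel_measurable_times borel_measurable_diff borel_measurable_const
      borel_measurable_g_rank assms)

text \<open>The ranks influence the matching only through the order. Any property of the order
  becomes a finite disjunction, over comparison patterns, of finite conjunctions of measurable
  comparisons, so nothing has to be assumed about \<open>H\<close>.\<close>

lemma pred_probing_order:
  assumes ps: "set ps \<subseteq> L \<times> UNIV"
  shows "Measurable.pred (rank_space L) (\<lambda>y. H (probing_order w ps y))"
proof -
  define S where "S = set ps"
  define le where "le y p q \<longleftrightarrow> - perturbed_weight w y p \<le> - perturbed_weight w y q" for y p q
  \<comment> \<open>The probing order depends on \<open>y\<close> only through this relation, which takes finitely many values.\<close>
  define rel where "rel y = {c \<in> S \<times> S. le y (fst c) (snd c)}" for y
  define T where "T = rel ` {y. H (probing_order w ps y)}"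
  have rel_eq: "rel y = rel z \<longleftrightarrow> (\<forall>p\<in>S. \<forall>q\<in>S. (p, q) \<in> rel z \<longleftrightarrow> le y p q)" for y z
    unfolding rel_def by (auto simp: set_eq_iff)
  have order: "probing_order w ps y = probing_order w ps z" if eq: "rel y = rel z" for y z
    unfolding probing_order_def le_def[symmetric]
  proof (rule sort_key_cong_le)
    fix p q assume "p \<in> set ps" "q \<in> set ps"
    then have "(p, q) \<in> rel x \<longleftrightarrow> le x p q" for x by (simp add: S_def rel_def)
    then have "le y p q \<longleftrightarrow> le z p q" using eq by blast
    then show "- perturbed_weight w y p \<le> - perturbed_weight w y q \<longleftrightarrow>
        - perturbed_weight w z p \<le> - perturbed_weight w z q"
      unfolding le_def .
  qed
  have H_iff: "H (probing_order w ps y) \<longleftrightarrow> (\<exists>r\<in>T. rel y = r)" for y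
  proof
    assume "\<exists>r\<in>T. rel y = r"
    then obtain z where z: "rel y = rel z" "H (probing_order w ps z)"
      unfolding T_def by blast
    show "H (probing_order w ps y)" unfolding order[OF z(1)] by (rule z(2))
  qed (auto simp: T_def)
  \<comment> \<open>The right-hand side sees \<open>r\<close> only on \<open>S \<times> S\<close>;
    membership in \<open>T\<close> excludes any further pairs in \<open>r\<close>.\<close>
  have rel_iff: "rel y = r \<longleftrightarrow> (\<forall>p\<in>S. \<forall>q\<in>S. (p, q) \<in> r \<longleftrightarrow> le y p q)" if r: "r \<in> T" for r y
  proof -
    obtain z where "r = rel z" using r unfolding T_def by blast
    then show ?thesis using rel_eq by blast
  qed
  have eq: "H (probing_order w ps y) \<longleftrightarrow>
      (\<exists>r\<in>T. \<forall>p\<in>S. \<forall>q\<in>S. (p, q) \<in> r \<longleftrightarrow> le y p q)" for y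
    unfolding H_iff by (intro bex_cong refl rel_iff)
  have "T \<subseteq> Pow (S \<times> S)" by (auto simp: T_def rel_def)
  moreover have "finite S" by (simp add: S_def)
  ultimately have fin: "finite S" "finite T"
    by (auto intro: finite_subset)
  have pw: "(\<lambda>y. perturbed_weight w y p) \<in> borel_measurable (rank_space L)" if "p \<in> S" for p
    using that ps by (intro borel_measurable_perturbed_weight) (auto simp: S_def)
  have le: "Measurable.pred (rank_space L) (\<lambda>y. le y p q)" if "p \<in> S" "q \<in> S" for p q
    using borel_measurable_le[OF pw[OF that(2)] pw[OF that(1)]]
    unfolding le_def pred_def neg_le_iff_le .
  have "Measurable.pred (rank_space L) (\<lambda>y. (p, q) \<in> r \<longleftrightarrow> le y p q)"
    if "p \<in> S" "q \<in> S" for p q r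
    using le[OF that] by (cases "(p, q) \<in> r") simp_all
  then show ?thesis
    unfolding eq by (intro pred_intros_finite(3,4) fin)
qed

section \<open>Splitting the weight of a matching among the vertices\<close>

definition left_gain :: "('a \<Rightarrow> 'b \<Rightarrow> real) \<Rightarrow> ('a \<Rightarrow> real) \<Rightarrow> ('a \<times> 'b) set \<Rightarrow> 'a \<Rightarrow> real" where
  "left_gain w y M u = (\<Sum>p\<in>{p \<in> M. fst p = u}. g (y u) * w u (snd p))"

text \<open>The two gains play the role of dual variables. In a matching each sum has at most one
  term, and the empty sum gives an unmatched vertex gain 0 without a case distinction.\<close>

definition right_gain :: "('a \<Rightarrow> 'b \<Rightarrow> real) \<Rightarrow> ('a \<Rightarrow> real) \<Rightarrow> ('a \<times> 'b) set \<Rightarrow> 'b \<Rightarrow> real" where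
  "right_gain w y M v = (\<Sum>p\<in>{p \<in> M. snd p = v}. perturbed_weight w y p)"

lemma left_gain_eq:
  assumes "is_matching E M" "(u, v) \<in> M"
  shows "left_gain w y M u = g (y u) * w u v"
proof -
  have "{p \<in> M. fst p = u} = {(u, v)}"
    using assms by (force simp: is_matching_def)
  then show ?thesis by (simp add: left_gain_def)
qed

lemma right_gain_eq:
  assumes "is_matching E M" "(u, v) \<in> M"
  shows "right_gain w y M v = perturbed_weight w y (u, v)"
proof -
  have "{p \<in> M. snd p = v} = {(u, v)}"
    using assms by (force simp: is_matching_def)
  then show ?thesis by (simp add: right_gain_def)
qed

lemma weight_eq_gains:
  assumes "finite L" "finite R" "M \<subseteq> L \<times> R"
  shows "weight w M = (\<Sum>u\<in>L. left_gain w y M u) + (\<Sum>v\<in>R. right_gain w y M v)"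
proof -
  have M: "finite M" using finite_subset[OF assms(3)] assms(1,2) by simp
  have "(\<Sum>u\<in>L. left_gain w y M u) =
      (\<Sum>u\<in>L. \<Sum>p\<in>{p \<in> M. fst p = u}. g (y (fst p)) * w (fst p) (snd p))"
    unfolding left_gain_def by (intro sum.cong) auto
  also have "\<dots> = (\<Sum>p\<in>M. g (y (fst p)) * w (fst p) (snd p))"
    using assms M by (intro sum.group) auto
  finally have l: "(\<Sum>u\<in>L. left_gain w y M u) = \<dots>" .
  have "(\<Sum>v\<in>R. right_gain w y M v) = (\<Sum>p\<in>M. perturbed_weight w y p)"
    unfolding right_gain_def using assms M by (intro sum.group) auto
  then show ?thesis
    unfolding l weight_def
    by (simp add: sum.distrib[symmetric] perturbed_weight_def case_prod_beta algebra_simps)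
qed

lemma gains_nonneg:
  assumes "M \<subseteq> L \<times> R" "\<And>u v. u \<in> L \<Longrightarrow> v \<in> R \<Longrightarrow> 0 \<le> w u v" "\<And>u. u \<in> L \<Longrightarrow> y u \<le> 1"
  shows "0 \<le> left_gain w y M u" "0 \<le> right_gain w y M v"
  unfolding left_gain_def right_gain_def
  using assms g_bounds
  by (auto intro!: sum_nonneg mult_nonneg_nonneg simp: perturbed_weight_def less_imp_le subset_iff)

text \<open>\<open>N\<close> meets every vertex at most once, so its edges collect distinct gains of
  \<open>M\<close>. The gains left out are nonnegative, and all gains together make up the weight
  because the shares \<open>g\<close> and \<open>1 - g\<close> add up to 1.\<close>

lemma sum_gains_le_weight:
  assumes "finite L" "finite R" "M \<subseteq> L \<times> R" "N \<subseteq> L \<times> R" "is_matching E N"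
    and "\<And>u v. u \<in> L \<Longrightarrow> v \<in> R \<Longrightarrow> 0 \<le> w u v" "\<And>u. u \<in> L \<Longrightarrow> y u \<le> 1"
  shows "(\<Sum>(u, v)\<in>N. left_gain w y M u + right_gain w y M v) \<le> weight w M"
proof -
  have inj: "inj_on fst N" "inj_on snd N"
    using \<open>is_matching E N\<close> unfolding is_matching_def inj_on_def by blast+
  have "(\<Sum>p\<in>N. left_gain w y M (fst p)) = (\<Sum>u\<in>fst ` N. left_gain w y M u)"
    by (simp add: sum.reindex[OF inj(1)])
  also have "\<dots> \<le> (\<Sum>u\<in>L. left_gain w y M u)"
    using assms by (intro sum_mono2 gains_nonneg) auto
  finally have l: "(\<Sum>p\<in>N. left_gain w y M (fst p)) \<le> (\<Sum>u\<in>L. left_gain w y M u)" .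
  have "(\<Sum>p\<in>N. right_gain w y M (snd p)) = (\<Sum>v\<in>snd ` N. right_gain w y M v)"
    by (simp add: sum.reindex[OF inj(2)])
  also have "\<dots> \<le> (\<Sum>v\<in>R. right_gain w y M v)"
    using assms by (intro sum_mono2 gains_nonneg) auto
  finally have r: "(\<Sum>p\<in>N. right_gain w y M (snd p)) \<le> (\<Sum>v\<in>R. right_gain w y M v)" .
  show ?thesis
    using l r weight_eq_gains[OF assms(1-3), of w y] by (simp add: case_prod_beta sum.distrib)
qed

section \<open>Uniform ranks and integration over the rank of one vertex\<close>

definition unit_uniform :: "real measure" where
  "unit_uniform = uniform_measure lborel {0..1}"

lemma prob_space_unit_uniform: "prob_space unit_uniform"
  unfolding unit_uniform_def by (intro prob_space_uniform_measure) auto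

lemma AE_unit_uniform: "AE x in unit_uniform. 0 \<le> x \<and> x \<le> 1"
  unfolding unit_uniform_def by (intro AE_uniform_measureI) auto

lemma rank_space_eq: "rank_space L = (\<Pi>\<^sub>M u\<in>L. unit_uniform)"
  by (simp add: rank_space_def unit_uniform_def)

text \<open>The underlying space contains arbitrary real ranks, so the bounds behind nonnegative
  gains are available only almost everywhere.\<close>

lemma AE_rank_space:
  assumes "finite L"
  shows "AE y in rank_space L. \<forall>u\<in>L. 0 \<le> y u \<and> y u \<le> 1"
  unfolding rank_space_eq
  by (intro AE_finite_allI assms AE_PiM_component prob_space_unit_uniform AE_unit_uniform)

lemma nn_integral_unit_uniform:
  assumes "f \<in> borel_measurable borel"
  shows "(\<integral>\<^sup>+x. f x \<partial>unit_uniform) = (\<integral>\<^sup>+x. f x * indicator {0..1} x \<partial>lborel)"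
  using assms unfolding unit_uniform_def
  by (subst nn_integral_uniform_measure) (auto simp: divide_ennreal_def)

text \<open>Here \<open>f x\<close> stands for the joint gain of an edge of weight \<open>c\<close>
  when its left endpoint has rank \<open>x\<close>, and \<open>b\<close> for the gain of its right
  endpoint without the left one. If \<open>b\<close> is small, the extra \<open>g x * c\<close> is
  earned up to a threshold \<open>t\<close>, and
  \<open>b + (g t - g 0) * c = b + (c - b) - c / e\<close> is the claimed bound.\<close>

lemma nn_integral_threshold_bound:
  assumes "0 \<le> b" "0 \<le> c"
    and f: "f \<in> borel_measurable borel"
    and low: "\<And>x. 0 \<le> x \<Longrightarrow> x \<le> 1 \<Longrightarrow> b \<le> f x"
    and high: "\<And>x. 0 \<le> x \<Longrightarrow> x \<le> 1 \<Longrightarrow> b < (1 - g x) * c \<Longrightarrow> b + g x * c \<le> f x"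
  shows "ennreal ((1 - 1 / exp 1) * c) \<le> (\<integral>\<^sup>+x. ennreal (f x) \<partial>unit_uniform)"
proof (cases "(1 - 1 / exp 1) * c \<le> b")
  case True
  interpret prob_space unit_uniform by (rule prob_space_unit_uniform)
  have "ennreal ((1 - 1 / exp 1) * c) = (\<integral>\<^sup>+x. ennreal ((1 - 1 / exp 1) * c) \<partial>unit_uniform)"
    by (simp add: emeasure_space_1)
  also have "\<dots> \<le> (\<integral>\<^sup>+x. ennreal (f x) \<partial>unit_uniform)"
  proof (intro nn_integral_mono_AE, use AE_unit_uniform in eventually_elim)
    fix x :: real assume "0 \<le> x \<and> x \<le> 1"
    then show "ennreal ((1 - 1 / exp 1) * c) \<le> ennreal (f x)"
      using True low[of x] by (intro ennreal_leI) linarith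
  qed
  finally show ?thesis .
next
  case False
  have "c \<noteq> 0" using False assms(1) by auto
  then have c: "c > 0" using assms(2) by simp
  \<comment> \<open>\<open>t\<close> solves \<open>(1 - g t) * c = b\<close>; as \<open>g\<close> is its own antiderivative, the gain on \<open>[0, t]\<close> is
    exactly what \<open>b\<close> lacks.\<close>
  define t where "t = 1 + ln (1 - b / c)"
  \<comment> \<open>This serves twice: the argument of the logarithm is positive, and it exceeds
    \<open>g 0 = 1 / e\<close>, which places \<open>t\<close> to the right of 0.\<close>
  have bc: "1 / exp 1 < 1 - b / c" using False c by (simp add: field_simps)
  then have pos: "0 < 1 - b / c" by (smt (verit) divide_pos_pos exp_gt_zero)
  have gt: "g t = 1 - b / c" using pos by (simp add: g_def t_def)
  have "ln (1 / exp 1) \<le> ln (1 - b / c)" using bc pos by (intro ln_mono) auto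
  then have t0: "0 \<le> t" by (simp add: t_def ln_div)
  have "ln (1 - b / c) \<le> 0" using pos assms(1) c by simp
  then have t1: "t \<le> 1" by (simp add: t_def)
  have g_less: "b < (1 - g x) * c" if "x < t" for x
  proof -
    have "g x < g t" using that by (simp add: g_def)
    then show ?thesis using gt c by (simp add: field_simps)
  qed
  have deriv: "(g has_real_derivative g x) (at x)" for x
    unfolding g_def[abs_def] by (auto intro!: derivative_eq_intros)
  have gc: "(\<lambda>x. g x * c) \<in> borel_measurable borel"
    by (intro borel_measurable_times g_measurable borel_measurable_const)
  have "(\<integral>\<^sup>+x. ennreal (g x * c) * indicator {0..t} x \<partial>lborel) = ennreal (g t * c - g 0 * c)"
    by (rule nn_integral_FTC_Icc[where F = "\<lambda>x. g x * c", OF gc DERIV_cmult_right[OF deriv] _ t0])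
      (intro mult_nonneg_nonneg less_imp_le g_bounds(2) c)
  also have "g t * c - g 0 * c = (1 - 1 / exp 1) * c - b"
  proof -
    have "g 0 = 1 / exp 1" by (simp add: g_def exp_minus inverse_eq_divide)
    moreover have "g t * c = c - b" unfolding gt using c by (simp add: left_diff_distrib)
    ultimately show ?thesis by (simp add: left_diff_distrib)
  qed
  finally have int: "(\<integral>\<^sup>+x. ennreal (g x * c) * indicator {0..t} x \<partial>lborel) =
    ennreal ((1 - 1 / exp 1) * c - b)" .
  \<comment> \<open>By the case assumption the difference is nonnegative, so \<open>ennreal\<close>
    does not truncate it.\<close>
  have "ennreal ((1 - 1 / exp 1) * c) = ennreal b + ennreal ((1 - 1 / exp 1) * c - b)"
    using False assms(1) by (simp add: ennreal_plus[symmetric] del: ennreal_plus)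
  also have "\<dots> = (\<integral>\<^sup>+(x::real). ennreal b * indicator {0..1} x \<partial>lborel) +
      (\<integral>\<^sup>+x. ennreal (g x * c) * indicator {0..t} x \<partial>lborel)"
    by (simp add: int nn_integral_cmult_indicator)
  also have "\<dots> = (\<integral>\<^sup>+x. ennreal b * indicator {0..1} x +
      ennreal (g x * c) * indicator {0..t} x \<partial>lborel)"
    by (rule nn_integral_add[symmetric])
      (intro borel_measurable_times_ennreal borel_measurable_indicator
        borel_measurable_const measurable_compose[OF _ measurable_ennreal];
        use gc in simp)+
  \<comment> \<open>The extra gain is known only for \<open>x < t\<close>; the point
    \<open>t\<close> itself is a null set.\<close>
  also have "\<dots> \<le> (\<integral>\<^sup>+x. ennreal (f x) * indicator {0..1} x \<partial>lborel)"
  proof (intro nn_integral_mono_AE, use AE_lborel_singleton[of t] in eventually_elim)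
    fix x assume x: "x \<noteq> t"
    show "ennreal b * indicator {0..1} x + ennreal (g x * c) * indicator {0..t} x
        \<le> ennreal (f x) * indicator {0..1} x"
    proof (cases "0 \<le> x \<and> x < t")
      case True
      then have "b + g x * c \<le> f x" using high g_less t1 by auto
      then have "ennreal b + ennreal (g x * c) \<le> ennreal (f x)"
        using assms(1) c g_bounds(2)[of x] by (simp add: ennreal_plus[symmetric] ennreal_leI del: ennreal_plus)
      then show ?thesis using True t1 by simp
    qed (use x low in \<open>auto simp: indicator_def intro!: ennreal_leI\<close>)
  qed
  also have "\<dots> = (\<integral>\<^sup>+x. ennreal (f x) \<partial>unit_uniform)"
    using f by (intro nn_integral_unit_uniform[symmetric]) auto
  finally show ?thesis .
qed

text \<open>The rank of \<open>u\<close> enters only the keys of pairs at \<open>u\<close>, none of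
  which is an edge after the deletion. This makes the threshold \<open>b\<close> constant while the
  rank of \<open>u\<close> varies.\<close>

lemma right_gain_remove_vertex_cong:
  assumes "\<And>a. a \<noteq> u \<Longrightarrow> y a = z a"
  shows "right_gain w y (weighted_ranking w ps {p \<in> E. fst p \<noteq> u} y) v =
    right_gain w z (weighted_ranking w ps {p \<in> E. fst p \<noteq> u} z) v"
proof -
  let ?E = "{p \<in> E. fst p \<noteq> u}"
  have pw: "perturbed_weight w y p = perturbed_weight w z p" if "fst p \<noteq> u" for p
    using assms that by (simp add: perturbed_weight_def case_prod_beta)
  \<comment> \<open>Stable sorting commutes with filtering, so only keys of pairs avoiding
    \<open>u\<close> remain to be compared.\<close>
  have "filter (\<lambda>p. fst p \<noteq> u) (probing_order w ps y) = filter (\<lambda>p. fst p \<noteq> u) (probing_order w ps z)"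
    unfolding probing_order_def filter_sort
    by (rule sort_key_cong_le) (simp add: pw)
  then have eq: "weighted_ranking w ps ?E y = weighted_ranking w ps ?E z"
    unfolding weighted_ranking_def
    by (subst (1 2) query_commit_filter[of E "\<lambda>p. fst p \<noteq> u"]) simp
  have "fst p \<noteq> u" if "p \<in> weighted_ranking w ps ?E z" for p
    using that query_commit_subset[of ?E] unfolding weighted_ranking_def by blast
  then show ?thesis
    unfolding right_gain_def eq by (intro sum.cong) (auto simp: pw)
qed

section \<open>Expected gains and expected weight on a fixed instance\<close>

locale ranking =
  fixes L :: "'a set" and R :: "'b set" and E :: "('a \<times> 'b) set"
    and w :: "'a \<Rightarrow> 'b \<Rightarrow> real" and ps :: "('a \<times> 'b) list"
  assumes finite_L: "finite L" and finite_R: "finite R" and E: "E \<subseteq> L \<times> R"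
    and w_nonneg: "\<And>u v. u \<in> L \<Longrightarrow> v \<in> R \<Longrightarrow> 0 \<le> w u v"
    and set_ps: "set ps = L \<times> R"
begin

abbreviation ranking_matching :: "('a \<Rightarrow> real) \<Rightarrow> ('a \<times> 'b) set" where
  "ranking_matching \<equiv> weighted_ranking w ps E"

lemma weighted_ranking_subset: "weighted_ranking w ps F y \<subseteq> F \<inter> L \<times> R"
  using query_commit_subset[of F "probing_order w ps y"] set_ps
  by (auto simp: weighted_ranking_def probing_order_def)

lemma weight_nonneg: "0 \<le> weight w (ranking_matching y)"
  using weighted_ranking_subset[of E y] w_nonneg
  unfolding weight_def by (auto intro!: sum_nonneg)

text \<open>The index set is random. Summing over the fixed finite set \<open>L \<times> R\<close>
  moves the randomness into membership conditions, which are properties of the probing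
  order.\<close>

lemma borel_measurable_sum_matching:
  fixes c :: "'a \<times> 'b \<Rightarrow> ('a \<Rightarrow> real) \<Rightarrow> real"
  assumes "\<And>p. p \<in> L \<times> R \<Longrightarrow> c p \<in> borel_measurable (rank_space L)"
  shows "(\<lambda>y. \<Sum>p\<in>{p \<in> ranking_matching y. P p}. c p y) \<in> borel_measurable (rank_space L)"
proof -
  have "(\<Sum>p\<in>{p \<in> ranking_matching y. P p}. c p y) =
      (\<Sum>p\<in>L \<times> R. if p \<in> ranking_matching y \<and> P p then c p y else 0)" for y
    using weighted_ranking_subset[of E y] finite_L finite_R
    by (subst sum.inter_filter[symmetric]) (auto intro!: sum.cong)
  then have eq: "(\<lambda>y. \<Sum>p\<in>{p \<in> ranking_matching y. P p}. c p y) =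
      (\<lambda>y. \<Sum>p\<in>L \<times> R. if p \<in> ranking_matching y \<and> P p then c p y else 0)"
    by (rule ext)
  have pred: "Measurable.pred (rank_space L) (\<lambda>y. p \<in> ranking_matching y \<and> P p)" for p
    unfolding weighted_ranking_def
    by (rule pred_probing_order[where H = "\<lambda>qs. p \<in> query_commit E qs \<and> P p"])
      (use set_ps in auto)
  show ?thesis
    unfolding eq
  proof (rule borel_measurable_sum)
    fix p assume "p \<in> L \<times> R"
    from measurable_If[OF assms[OF this] borel_measurable_const pred[unfolded pred_def]]
    show "(\<lambda>y. if p \<in> ranking_matching y \<and> P p then c p y else 0)
      \<in> borel_measurable (rank_space L)" .
  qed
qed

lemma borel_measurable_left_gain:
  assumes "u \<in> L"
  shows "(\<lambda>y. left_gain w y (ranking_matching y) u) \<in> borel_measurable (rank_space L)"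
  unfolding left_gain_def
  by (intro borel_measurable_sum_matching borel_measurable_times borel_measurable_const
      borel_measurable_g_rank assms)

lemma borel_measurable_right_gain:
  "(\<lambda>y. right_gain w y (ranking_matching y) v) \<in> borel_measurable (rank_space L)"
  unfolding right_gain_def
  by (intro borel_measurable_sum_matching borel_measurable_perturbed_weight) auto

lemma borel_measurable_weight:
  "(\<lambda>y. weight w (ranking_matching y)) \<in> borel_measurable (rank_space L)"
  using borel_measurable_sum_matching[of "\<lambda>p y. w (fst p) (snd p)" "\<lambda>_. True"]
  by (simp add: weight_def case_prod_beta)

lemma edge_gains:
  fixes u v y
  defines "b \<equiv> right_gain w y (weighted_ranking w ps {p \<in> E. fst p \<noteq> u} y) v"
  assumes uv: "(u, v) \<in> E" and y: "\<And>a. a \<in> L \<Longrightarrow> y a \<le> 1"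
  shows "0 \<le> b"
    and "b \<le> right_gain w y (ranking_matching y) v"
    and "b < (1 - g (y u)) * w u v \<Longrightarrow> g (y u) * w u v \<le> left_gain w y (ranking_matching y) u"
proof -
  let ?E = "{p \<in> E. fst p \<noteq> u}"
  let ?M' = "weighted_ranking w ps ?E y"
  have subs: "ranking_matching y \<subseteq> L \<times> R" "?M' \<subseteq> L \<times> R"
    using weighted_ranking_subset[of E y] weighted_ranking_subset[of ?E y] by auto
  note gain_nonneg = gains_nonneg[of _ L R w y, OF _ w_nonneg y]
  show b: "0 \<le> b"
    unfolding b_def by (rule gain_nonneg(2)[OF subs(2)])
  have sorted: "sorted (map (\<lambda>p. - perturbed_weight w y p) (probing_order w ps y))"
    by (simp add: probing_order_def)
  show "b \<le> right_gain w y (ranking_matching y) v"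
  proof (cases "\<exists>a. (a, v) \<in> ?M'")
    case True
    then obtain a where a: "(a, v) \<in> ?M'" by blast
    then obtain a' where a': "(a', v) \<in> ranking_matching y"
      "perturbed_weight w y (a, v) \<le> perturbed_weight w y (a', v)"
      using query_commit_vertex_improves[OF sorted] unfolding weighted_ranking_def by blast
    have "b = perturbed_weight w y (a, v)"
      unfolding b_def by (rule right_gain_eq[OF is_matching_weighted_ranking a])
    with a' show ?thesis
      using right_gain_eq[OF is_matching_weighted_ranking a'(1), of w y] by simp
  next
    case False
    then have "{p \<in> ?M'. snd p = v} = {}" by auto
    then have "b = 0" unfolding b_def right_gain_def by (metis sum.empty)
    then show ?thesis using gain_nonneg(2)[OF subs(1), of v] by simp
  qed
  assume less: "b < (1 - g (y u)) * w u v"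
  have "\<exists>v'. (u, v') \<in> ranking_matching y \<and> perturbed_weight w y (u, v) \<le> perturbed_weight w y (u, v')"
    unfolding weighted_ranking_def
  proof (rule query_commit_vertex_matched[OF sorted uv])
    show "(u, v) \<in> set (probing_order w ps y)"
      using uv E set_ps by (auto simp: probing_order_def)
    \<comment> \<open>A partner of \<open>v\<close> in the matching without \<open>u\<close> is
      unique, so its perturbed weight is \<open>b\<close> and \<open>less\<close> supplies the
      comparison.\<close>
    fix a assume "(a, v) \<in> query_commit ?E (probing_order w ps y)"
    then have "(a, v) \<in> ?M'" by (simp only: weighted_ranking_def)
    then have "b = perturbed_weight w y (a, v)"
      unfolding b_def by (rule right_gain_eq[OF is_matching_weighted_ranking])
    then show "perturbed_weight w y (a, v) < perturbed_weight w y (u, v)"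
      using less by (simp add: perturbed_weight_def)
  qed
  then obtain v' where v': "(u, v') \<in> ranking_matching y"
    "(1 - g (y u)) * w u v \<le> (1 - g (y u)) * w u v'"
    by (auto simp: perturbed_weight_def)
  have u: "u \<in> L" "v \<in> R" using uv E by auto
  \<comment> \<open>Both pairs share \<open>u\<close>, so the comparison of perturbed weights
    descends to \<open>w\<close> once the common factor is positive. It would say nothing at rank 1,
    where the factor vanishes; \<open>b \<ge> 0\<close> and \<open>less\<close> exclude
    this.\<close>
  have "0 < (1 - g (y u)) * w u v" using b less by linarith
  then have "0 < 1 - g (y u)" using w_nonneg[OF u] by (simp add: zero_less_mult_iff)
  then have "w u v \<le> w u v'" using v'(2) by simp
  then have "g (y u) * w u v \<le> g (y u) * w u v'"
    using g_bounds(2)[of "y u"] by simp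
  then show "g (y u) * w u v \<le> left_gain w y (ranking_matching y) u"
    using left_gain_eq[OF is_matching_weighted_ranking v'(1), of w y] by simp
qed

text \<open>By Fubini the ranks of the other left vertices are fixed first. For almost every choice
  of them, the inner integral over the rank of \<open>u\<close> is an instance of the threshold
  bound.\<close>

lemma expected_edge_gains:
  assumes uv: "(u, v) \<in> E"
  shows "ennreal ((1 - 1 / exp 1) * w u v) \<le>
    (\<integral>\<^sup>+y. ennreal (left_gain w y (ranking_matching y) u + right_gain w y (ranking_matching y) v)
      \<partial>rank_space L)"
proof -
  define f where "f y = left_gain w y (ranking_matching y) u + right_gain w y (ranking_matching y) v" for y
  define L' where "L' = L - {u}"
  have u: "u \<in> L" "v \<in> R" using uv E by auto
  have L: "L = insert u L'" "finite L'" "u \<notin> L'" using u finite_L by (auto simp: L'_def)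
  interpret U: prob_space unit_uniform by (rule prob_space_unit_uniform)
  interpret P: product_sigma_finite "\<lambda>_. unit_uniform" by standard
  interpret L': prob_space "rank_space L'" by (rule prob_space_rank_space)
  have f: "f \<in> borel_measurable (rank_space L)"
    unfolding f_def
    by (intro borel_measurable_add borel_measurable_left_gain borel_measurable_right_gain u)
  have "ennreal ((1 - 1 / exp 1) * w u v) = (\<integral>\<^sup>+x. ennreal ((1 - 1 / exp 1) * w u v) \<partial>rank_space L')"
    by (simp add: L'.emeasure_space_1)
  also have "\<dots> \<le> (\<integral>\<^sup>+x. (\<integral>\<^sup>+t. ennreal (f (x(u := t))) \<partial>unit_uniform) \<partial>rank_space L')"
  proof (intro nn_integral_mono_AE, use AE_rank_space[OF L(2)] AE_space in eventually_elim)
    fix x assume x: "\<forall>a\<in>L'. 0 \<le> x a \<and> x a \<le> 1" "x \<in> space (rank_space L')"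
    let ?b = "\<lambda>y. right_gain w y (weighted_ranking w ps {p \<in> E. fst p \<noteq> u} y) v"
    \<comment> \<open>\<open>x\<close> carries no rank for \<open>u\<close>; rank 0 serves as a
      representative for the common value of \<open>?b\<close>.\<close>
    have b: "?b (x(u := t)) = ?b (x(u := 0))" for t
      by (rule right_gain_remove_vertex_cong) simp
    have y: "(x(u := t)) a \<le> 1" if "a \<in> L" "t \<le> 1" for a t
      using that x(1) L(1) by auto
    have gains: "0 \<le> ?b (x(u := 0))"
        "?b (x(u := 0)) \<le> right_gain w (x(u := t)) (ranking_matching (x(u := t))) v"
        "?b (x(u := 0)) < (1 - g t) * w u v \<Longrightarrow>
          g t * w u v \<le> left_gain w (x(u := t)) (ranking_matching (x(u := t))) u"
      if "t \<le> 1" for t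
      using edge_gains[of u v "x(u := t)", OF uv y[OF _ that]]
      unfolding b[of t] fun_upd_same by simp_all
    have upd: "(\<lambda>t. x(u := t)) \<in> measurable unit_uniform (rank_space L)"
      using measurable_component_update[OF x(2)[unfolded rank_space_eq] L(3)]
      unfolding rank_space_eq L(1) .
    show "ennreal ((1 - 1 / exp 1) * w u v) \<le> (\<integral>\<^sup>+t. ennreal (f (x(u := t))) \<partial>unit_uniform)"
    proof (rule nn_integral_threshold_bound)
      show "0 \<le> ?b (x(u := 0))" using gains(1)[of 0] by (simp only: zero_le_one)
      show "0 \<le> w u v" by (rule w_nonneg[OF u])
      show "(\<lambda>t. f (x(u := t))) \<in> borel_measurable borel"
        using measurable_compose[OF upd f]
        by (simp add: unit_uniform_def)
      fix t :: real assume t: "0 \<le> t" "t \<le> 1"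
      have "ranking_matching (x(u := t)) \<subseteq> L \<times> R"
        using weighted_ranking_subset[of E] by auto
      then have "0 \<le> left_gain w (x(u := t)) (ranking_matching (x(u := t))) u"
        by (rule gains_nonneg(1)) (rule w_nonneg y[OF _ t(2)]; assumption)+
      then show "?b (x(u := 0)) \<le> f (x(u := t))"
        using gains(2)[OF t(2)] unfolding f_def by linarith
      assume "?b (x(u := 0)) < (1 - g t) * w u v"
      then show "?b (x(u := 0)) + g t * w u v \<le> f (x(u := t))"
        using gains(2,3)[OF t(2)] unfolding f_def by linarith
    qed
  qed
  also have "\<dots> = (\<integral>\<^sup>+y. ennreal (f y) \<partial>rank_space L)"
    unfolding rank_space_eq L(1)
    by (rule P.product_nn_integral_insert[symmetric])
      (use L f in \<open>auto simp: rank_space_eq\<close>)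
  finally show ?thesis unfolding f_def .
qed

text \<open>The total absolute weight of \<open>L \<times> R\<close> bounds every outcome.
  Integrability is what turns the nonnegative integrals of the gains back into the expectation of
  the theorem.\<close>

lemma integrable_weight: "integrable (rank_space L) (\<lambda>y. weight w (ranking_matching y))"
proof -
  interpret prob_space "rank_space L" by (rule prob_space_rank_space)
  have "norm (weight w (ranking_matching y)) \<le> (\<Sum>(u, v)\<in>L \<times> R. \<bar>w u v\<bar>)" for y
  proof -
    have "norm (weight w (ranking_matching y)) \<le> (\<Sum>(u, v)\<in>ranking_matching y. \<bar>w u v\<bar>)"
      unfolding weight_def real_norm_def case_prod_beta by (rule sum_abs)
    also have "\<dots> \<le> (\<Sum>(u, v)\<in>L \<times> R. \<bar>w u v\<bar>)"
      using finite_L finite_R weighted_ranking_subset[of E y]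
      by (intro sum_mono2) auto
    finally show ?thesis .
  qed
  then show ?thesis
    by (intro integrable_const_bound[OF _ borel_measurable_weight] AE_I2)
qed

text \<open>Each edge of \<open>N\<close> has its expected share, and by linearity these add up
  inside the integral. There, for almost all ranks, disjointness of the edges keeps their gains
  within the weight of the produced matching.\<close>

lemma expected_weight_ge_matching:
  assumes N: "is_matching E N"
  shows "(1 - 1 / exp 1) * weight w N \<le> (\<integral>y. weight w (ranking_matching y) \<partial>rank_space L)"
proof -
  define gain where "gain = (\<lambda>y (u, v).
    left_gain w y (ranking_matching y) u + right_gain w y (ranking_matching y) v)"
  have sub: "N \<subseteq> E" "N \<subseteq> L \<times> R" using N E by (auto simp: is_matching_def)
  have nonneg: "0 \<le> (1 - 1 / exp 1) * w (fst p) (snd p)" if "p \<in> N" for p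
    using that sub(2) by (intro mult_nonneg_nonneg w_nonneg) auto
  have "ennreal ((1 - 1 / exp 1) * weight w N) = (\<Sum>p\<in>N. ennreal ((1 - 1 / exp 1) * w (fst p) (snd p)))"
    unfolding weight_def case_prod_beta sum_distrib_left
    by (rule sum_ennreal[symmetric]) (rule nonneg)
  also have "\<dots> \<le> (\<Sum>p\<in>N. \<integral>\<^sup>+y. ennreal (gain y p) \<partial>rank_space L)"
  proof (rule sum_mono)
    fix p assume "p \<in> N"
    then show "ennreal ((1 - 1 / exp 1) * w (fst p) (snd p)) \<le> (\<integral>\<^sup>+y. ennreal (gain y p) \<partial>rank_space L)"
      using expected_edge_gains[of "fst p" "snd p"] sub(1) by (auto simp: gain_def case_prod_beta)
  qed
  also have "\<dots> = (\<integral>\<^sup>+y. (\<Sum>p\<in>N. ennreal (gain y p)) \<partial>rank_space L)"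
  proof (rule nn_integral_sum[symmetric])
    fix p assume "p \<in> N"
    then have "fst p \<in> L" using sub(2) by auto
    then show "(\<lambda>y. ennreal (gain y p)) \<in> borel_measurable (rank_space L)"
      unfolding gain_def case_prod_beta
      by (intro measurable_compose[OF _ measurable_ennreal] borel_measurable_add
          borel_measurable_left_gain borel_measurable_right_gain)
  qed
  also have "\<dots> \<le> (\<integral>\<^sup>+y. ennreal (weight w (ranking_matching y)) \<partial>rank_space L)"
  proof (intro nn_integral_mono_AE, use AE_rank_space[OF finite_L] in eventually_elim)
    fix y :: "'a \<Rightarrow> real"
    assume "\<forall>a\<in>L. 0 \<le> y a \<and> y a \<le> 1"
    then have y: "y a \<le> 1" if "a \<in> L" for a using that by blast
    have M: "ranking_matching y \<subseteq> L \<times> R" using weighted_ranking_subset[of E y] by auto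
    have "0 \<le> gain y p" for p
      using gains_nonneg[OF M w_nonneg y] unfolding gain_def case_prod_beta by (intro add_nonneg_nonneg)
    then have "(\<Sum>p\<in>N. ennreal (gain y p)) = ennreal (\<Sum>p\<in>N. gain y p)"
      by (intro sum_ennreal)
    also have "\<dots> \<le> ennreal (weight w (ranking_matching y))"
      using sum_gains_le_weight[OF finite_L finite_R M sub(2) N w_nonneg y]
      unfolding gain_def by (intro ennreal_leI)
    finally show "(\<Sum>p\<in>N. ennreal (gain y p)) \<le> ennreal (weight w (ranking_matching y))" .
  qed
  also have "\<dots> = ennreal (\<integral>y. weight w (ranking_matching y) \<partial>rank_space L)"
    by (intro nn_integral_eq_integral integrable_weight AE_I2 weight_nonneg)
  finally show ?thesis
    by (subst (asm) ennreal_le_iff) (auto intro!: Bochner_Integration.integral_nonneg weight_nonneg)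
qed

end

theorem theorem1:
  fixes L :: "'a set" and R :: "'b set" and E :: "('a \<times> 'b) set"
    and w :: "'a \<Rightarrow> 'b \<Rightarrow> real" and ps :: "('a \<times> 'b) list"
  assumes "finite L" and "finite R" and "E \<subseteq> L \<times> R"
    and "\<And>u v. u \<in> L \<Longrightarrow> v \<in> R \<Longrightarrow> w u v \<ge> 0"
    and "distinct ps" and "set ps = L \<times> R"
  shows "(\<integral>y. weight w (weighted_ranking w ps E y) \<partial>rank_space L)
           \<ge> (1 - 1 / exp 1) * max_matching_weight w E"
proof -
  interpret ranking L R E w ps
    using assms by unfold_locales
  have "finite E" using finite_subset[OF E] finite_L finite_R by simp
  moreover have "{M. is_matching E M} \<subseteq> Pow E" "{} \<in> {M. is_matching E M}"
    by (auto simp: is_matching_def)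
  ultimately have "finite {M. is_matching E M}" "{M. is_matching E M} \<noteq> {}"
    by (auto intro: finite_subset[of _ "Pow E"])
  \<comment> \<open>The maximum is attained, so the bound for one matching suffices.\<close>
  then have "max_matching_weight w E \<in> weight w ` {M. is_matching E M}"
    unfolding max_matching_weight_def by (intro Max_in) auto
  then show ?thesis
    using expected_weight_ge_matching by auto
qed

end
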